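(* Let $W(t;a,b)$ be the generating function for walks confined to the quarter plane using steps in $\{(-1,0),(0,-1),(1,-1),(1,0),(0,1)\}$, and let $W_2(t;a,b)$ be the generating function for walks confined to the quarter plane using the step multiset $\{(-1,0),(0,-1),(1,-1),(1,0),(0,1),(0,0),(0,0)\}$, in which the two copies of the trivial step $(0,0)$ are distinguished; in both, $t$ counts the number of steps and $a$ (resp. $b$) records the $x$-coordinate (resp. $y$-coordinate) of the ending point. Then $$W_2(x;a,b)=W\left(\frac{x}{1-2x};a,b\right)\frac{1}{1-2x}.$$ Moreover, denoting by $J(x;a,b):=I(x;1+a,1+b)$ the generating function for strong-Baxter permutations, it holds that $$J(x;a,b)=(1+a)(1+b)\,x\,W_2(x;a,b).$$
   Context: Walks start at the origin $(0,0)$ and stay in the quarter plane $\mathbb{N}^2=\{(i,j): i,j\geq 0\}$; the empty walk is allowed. A permutation $\pi=\pi_1\cdots\pi_n$ of $\{1,\dots,n\}$ is strong-Baxter if there are no indices $i<j$ and $k>j+1$ satisfying any of the following: $\pi_{j+1}<\pi_i<\pi_k<\pi_j$; $\pi_j<\pi_k<\pi_i<\pi_{j+1}$; $\pi_{j+1}<\pi_k<\pi_i<\pi_j$. For a permutation $\pi$ of size $n$ and $c\in\{1,\dots,n+1\}$, $\pi\cdot c$ is the permutation $\pi'$ of size $n+1$ with $\pi'_{n+1}=c$ and, for $i\leq n$, $\pi'_i=\pi_i$ if $\pi_i<c$ and $\pi'_i=\pi_i+1$ if $\pi_i\geq c$. The active sites of a strong-Baxter permutation $\pi$ of size $n$ are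 the values $c\in\{1,\dots,n+1\}$ such that $\pi\cdot c$ is strong-Baxter. The label of $\pi$ is $(h,k)$, where $h$ (resp. $k$) is the number of active sites $c$ of $\pi$ with $c\leq\pi_n$ (resp. $c>\pi_n$). $I(x;y,z)=\sum_\pi x^{|\pi|}y^{h(\pi)}z^{k(\pi)}$, the sum being over all strong-Baxter permutations $\pi$ of size $|\pi|\geq 1$, where $(h(\pi),k(\pi))$ is the label of $\pi$. *)

theory Defs
  imports
    "HOL-Library.Product_Plus"
    "HOL-Library.Multiset"
    "HOL-Combinatorics.Multiset_Permutations"
    "HOL-Computational_Algebra.Formal_Power_Series"
begin

section \<open>Quarter-plane walks with a multiset of steps\<close>

text \<open>
  The copies of a repeated step are distinguished: a step is a vector together with
  the number of the copy being used.
\<close>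

definition step_copies :: "(int \<times> int) multiset \<Rightarrow> ((int \<times> int) \<times> nat) set" where
  "step_copies S = {(s, i). i < count S s}"

definition endpoint :: "((int \<times> int) \<times> nat) list \<Rightarrow> int \<times> int" where
  "endpoint w = sum_list (map fst w)"

definition quarter_walks :: "(int \<times> int) multiset \<Rightarrow> nat \<Rightarrow> ((int \<times> int) \<times> nat) list set" where
  "quarter_walks S n =
     {w. length w = n \<and> set w \<subseteq> step_copies S \<and>
         (\<forall>m\<le>n. 0 \<le> fst (endpoint (take m w)) \<and> 0 \<le> snd (endpoint (take m w)))}"

text \<open>
  Generating functions are power series in the size variable (\<open>t\<close> or \<open>x\<close>). Their coefficients
  are polynomials in the two catalytic variables, and the latter are arguments ranging over an
  arbitrary commutative ring, so that substitutions such as \<open>y := 1 + a\<close> are plain function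
  application; taking for the arguments the generators of a polynomial ring or of its field of
  fractions gives the series with formal catalytic variables.
\<close>

definition walk_gf :: "(int \<times> int) multiset \<Rightarrow> 'a::comm_ring_1 \<Rightarrow> 'a \<Rightarrow> 'a fps" where
  "walk_gf S a b =
     Abs_fps (\<lambda>n. \<Sum>w\<in>quarter_walks S n. a ^ nat (fst (endpoint w)) * b ^ nat (snd (endpoint w)))"

definition W :: "'a::comm_ring_1 \<Rightarrow> 'a \<Rightarrow> 'a fps" where
  "W = walk_gf {#(-1, 0), (0, -1), (1, -1), (1, 0), (0, 1)#}"

definition W\<^sub>2 :: "'a::comm_ring_1 \<Rightarrow> 'a \<Rightarrow> 'a fps" where
  "W\<^sub>2 = walk_gf {#(-1, 0), (0, -1), (1, -1), (1, 0), (0, 1), (0, 0), (0, 0)#}"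


section \<open>Strong-Baxter permutations\<close>

text \<open>
  A permutation of size \<open>n\<close> is the list of its values \<open>1, \<dots>, n\<close>. Positions are numbered from 0;
  the pattern conditions are invariant under this shift.
\<close>

definition strong_Baxter :: "nat list \<Rightarrow> bool" where
  "strong_Baxter \<pi> \<longleftrightarrow>
     \<pi> \<in> permutations_of_set {1..length \<pi>} \<and>
     \<not> (\<exists>i j k. i < j \<and> j + 1 < k \<and> k < length \<pi> \<and>
          (\<pi> ! (j + 1) < \<pi> ! i \<and> \<pi> ! i < \<pi> ! k \<and> \<pi> ! k < \<pi> ! j \<or>
           \<pi> ! j < \<pi> ! k \<and> \<pi> ! k < \<pi> ! i \<and> \<pi> ! i < \<pi> ! (j + 1) \<or>
           \<pi> ! (j + 1) < \<pi> ! k \<and> \<pi> ! k < \<pi> ! i \<and> \<pi> ! i < \<pi> ! j))"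

definition append_value :: "nat list \<Rightarrow> nat \<Rightarrow> nat list" where
  "append_value \<pi> c = map (\<lambda>p. if p < c then p else p + 1) \<pi> @ [c]"

definition active_sites :: "nat list \<Rightarrow> nat set" where
  "active_sites \<pi> = {c \<in> {1..length \<pi> + 1}. strong_Baxter (append_value \<pi> c)}"

definition label_h :: "nat list \<Rightarrow> nat" where
  "label_h \<pi> = card {c \<in> active_sites \<pi>. c \<le> last \<pi>}"

definition label_k :: "nat list \<Rightarrow> nat" where
  "label_k \<pi> = card {c \<in> active_sites \<pi>. c > last \<pi>}"

definition I :: "'a::comm_ring_1 \<Rightarrow> 'a \<Rightarrow> 'a fps" where
  "I y z =
     Abs_fps (\<lambda>n. \<Sum>\<pi> | strong_Baxter \<pi> \<and> length \<pi> = n \<and> n \<ge> 1. y ^ label_h \<pi> * z ^ label_k \<pi>)"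

definition J :: "'a::comm_ring_1 \<Rightarrow> 'a \<Rightarrow> 'a fps" where
  "J a b = I (1 + a) (1 + b)"

end

theory Submission
  imports Defs
begin

text \<open>
  Both identities compare a sum over objects of size \<open>n\<close> with a linear operator iterated
  \<open>n\<close> times on a test function.

  A walk of length \<open>n + 1\<close> is a walk of length \<open>n\<close> followed by an allowed step, so the sum of
  \<open>g (endpoint w)\<close> over the walks of length \<open>n + 1\<close> is the sum of \<open>step_op S g\<close> over the walks
  of length \<open>n\<close> (lemma \<open>walk_sum_Suc\<close>). A null step contributes \<open>g\<close> itself to \<open>step_op S g\<close>.
  Hence adding \<open>r\<close> null steps adds \<open>r\<close> times the identity to the operator, and the binomial
  theorem expresses the new sums through the old ones (\<open>walk_sum_null_steps\<close>). On generating
  functions this is the substitution of \<open>x / (1 - r x)\<close>: in front of every step and at the end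
  of the walk, an arbitrary sequence of null steps may be inserted.

  A strong-Baxter permutation of size \<open>n + 1 > 1\<close> arises exactly once by appending a value at an
  active site of a strong-Baxter permutation of size \<open>n\<close>. The labels of the permutations
  generated from one with label \<open>(h, k)\<close> are
  \<open>(1, k), \<dots>, (h - 1, k)\<close>, \<open>(h, k + 1)\<close> and \<open>(h + 1, 1), \<dots>, (h + 1, k)\<close> (\<open>growth_rule\<close>).
  The reason is that every consecutive pair of entries blocks a possibly empty interval of sites
  for the values appended later, and appending \<open>d\<close> changes the blocked sites only through the new pair
  (last entry, \<open>d\<close>), besides duplicating the site \<open>d\<close>.

  It remains to match the two operators. Setting \<open>y = 1 + a\<close> and \<open>z = 1 + b\<close> amounts to a
  binomial transform in each coordinate, since \<open>(1 + a)\<^sup>m\<close> is the transform of \<open>a\<^sup>i\<close>. The transform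
  turns the shift \<open>i \<mapsto> i + 1\<close> into a difference and the shift \<open>i \<mapsto> i - 1\<close>, cut off at 0, into a
  partial sum. It therefore carries the seven steps of \<open>W\<^sub>2\<close> exactly to the growth rule
  (\<open>children_sum_binomial_transform2\<close>). Unlike the functional equations of the two series, this
  argument divides neither by \<open>a\<close> nor by \<open>b\<close>, so it is valid for all values of the two arguments.
\<close>

unbundle fps_syntax


section \<open>Summing over walks step by step\<close>

definition walk_sum :: "(int \<times> int) multiset \<Rightarrow> (int \<times> int \<Rightarrow> 'a::comm_ring_1) \<Rightarrow> nat \<Rightarrow> 'a" where
  "walk_sum S g n = (\<Sum>w\<in>quarter_walks S n. g (endpoint w))"

abbreviation in_quarter :: "int \<times> int \<Rightarrow> bool" where
  "in_quarter p \<equiv> 0 \<le> fst p \<and> 0 \<le> snd p"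

text \<open>
  The operator adjoint to appending a step: it acts on test functions, not on distributions of
  endpoints.
\<close>

definition step_op :: "(int \<times> int) multiset \<Rightarrow> (int \<times> int \<Rightarrow> 'a::comm_ring_1) \<Rightarrow> int \<times> int \<Rightarrow> 'a" where
  "step_op S g p = (\<Sum>s\<in>#S. if in_quarter (p + s) then g (p + s) else 0)"

lemma step_copies_Sigma: "step_copies S = (SIGMA s:set_mset S. {..<count S s})"
  by (auto simp: step_copies_def simp flip: count_greater_zero_iff)

lemma finite_step_copies: "finite (step_copies S)"
  by (simp add: step_copies_Sigma)

lemma sum_mset_eq_sum_count: "(\<Sum>s\<in>#S. F s) = (\<Sum>s\<in>set_mset S. of_nat (count S s) * (F s :: 'a::comm_ring_1))"
proof (induction S)
  case (add x S)
  have "(\<Sum>s\<in>set_mset (add_mset x S). of_nat (count (add_mset x S) s) * F s)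
      = (\<Sum>s\<in>insert x (set_mset S). (if s = x then F x else 0) + of_nat (count S s) * F s)"
    by (auto intro!: sum.cong simp: algebra_simps)
  also have "\<dots> = F x + (\<Sum>s\<in>insert x (set_mset S). of_nat (count S s) * F s)"
    by (simp add: sum.distrib sum.delta)
  also have "(\<Sum>s\<in>insert x (set_mset S). of_nat (count S s) * F s) = (\<Sum>s\<in>set_mset S. of_nat (count S s) * F s)"
    by (rule sum.mono_neutral_right) (auto simp: not_in_iff)
  finally show ?case using add by simp
qed simp

lemma sum_step_copies: "(\<Sum>s\<in>step_copies S. F (fst s)) = (\<Sum>s\<in>#S. (F s :: 'a::comm_ring_1))"
proof -
  have "(\<Sum>s\<in>step_copies S. F (fst s)) = (\<Sum>(s, i)\<in>(SIGMA s:set_mset S. {..<count S s}). F s)"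
    unfolding step_copies_Sigma by (rule sum.cong) auto
  also have "\<dots> = (\<Sum>s\<in>set_mset S. \<Sum>i<count S s. F s)"
    by (rule sum.Sigma[symmetric]) auto
  finally show ?thesis by (simp add: sum_mset_eq_sum_count)
qed

lemma finite_quarter_walks: "finite (quarter_walks S n)"
proof (rule finite_subset)
  show "quarter_walks S n \<subseteq> {w. set w \<subseteq> step_copies S \<and> length w = n}"
    by (auto simp: quarter_walks_def)
  show "finite \<dots>" by (rule finite_lists_length_eq[OF finite_step_copies])
qed

lemma quarter_walks_0: "quarter_walks S 0 = {[]}"
  by (auto simp: quarter_walks_def endpoint_def)

lemma endpoint_quarter_walk: "w \<in> quarter_walks S n \<Longrightarrow> in_quarter (endpoint w)"
  by (auto simp: quarter_walks_def)

lemma endpoint_snoc: "endpoint (w @ [s]) = endpoint w + fst s"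
  by (simp add: endpoint_def)

lemma quarter_walks_snoc:
  "w @ [s] \<in> quarter_walks S (Suc n) \<longleftrightarrow>
     w \<in> quarter_walks S n \<and> s \<in> step_copies S \<and> in_quarter (endpoint w + fst s)"
proof -
  have split: "(\<forall>m\<le>Suc n. P m) \<longleftrightarrow> (\<forall>m\<le>n. P m) \<and> P (Suc n)" for P
    by (auto simp: le_Suc_eq)
  show ?thesis
    by (auto simp: quarter_walks_def split endpoint_snoc)
qed

lemma walk_sum_0: "walk_sum S g 0 = g (0, 0)"
  by (simp add: walk_sum_def quarter_walks_0 endpoint_def zero_prod_def)

text \<open>
  The test function is only evaluated inside the quarter plane. There a null step is always
  allowed, so that its contribution to \<open>step_op\<close> simplifies.
\<close>

lemma walk_sum_cong:
  "(\<And>p. in_quarter p \<Longrightarrow> g p = g' p) \<Longrightarrow> walk_sum S g n = walk_sum S g' n"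
  unfolding walk_sum_def by (intro sum.cong refl) (use endpoint_quarter_walk in blast)

lemma walk_sum_Suc: "walk_sum S g (Suc n) = walk_sum S (step_op S g) n"
proof -
  let ?E = "SIGMA w:quarter_walks S n. {s \<in> step_copies S. in_quarter (endpoint w + fst s)}"
  have "quarter_walks S (Suc n) = (\<lambda>(w, s). w @ [s]) ` ?E"
  proof (intro equalityI subsetI)
    fix v assume v: "v \<in> quarter_walks S (Suc n)"
    then have "v \<noteq> []" by (auto simp: quarter_walks_def)
    then obtain w s where "v = w @ [s]" by (metis rev_exhaust)
    with v show "v \<in> (\<lambda>(w, s). w @ [s]) ` ?E"
      by (auto simp: quarter_walks_snoc image_iff)
  qed (auto simp: quarter_walks_snoc)
  moreover have "inj_on (\<lambda>(w, s). w @ [s]) ?E" by (auto simp: inj_on_def)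
  ultimately have "walk_sum S g (Suc n) = (\<Sum>(w, s)\<in>?E. g (endpoint w + fst s))"
    unfolding walk_sum_def by (simp add: sum.reindex o_def case_prod_unfold endpoint_snoc)
  also have "\<dots> = (\<Sum>w\<in>quarter_walks S n. \<Sum>s\<in>{s \<in> step_copies S. in_quarter (endpoint w + fst s)}.
      g (endpoint w + fst s))"
    by (rule sum.Sigma[symmetric]) (auto simp: finite_quarter_walks finite_step_copies)
  also have "\<dots> = (\<Sum>w\<in>quarter_walks S n. \<Sum>s\<in>step_copies S.
      if in_quarter (endpoint w + fst s) then g (endpoint w + fst s) else 0)"
    by (intro sum.cong refl sum.inter_filter finite_step_copies)
  also have "\<dots> = walk_sum S (step_op S g) n"
    unfolding walk_sum_def step_op_def by (intro sum.cong refl sum_step_copies)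
  finally show ?thesis .
qed

lemma walk_sum_linear:
  "walk_sum S (\<lambda>p. g p + c * g' p) n = walk_sum S g n + c * walk_sum S g' n"
  by (simp add: walk_sum_def sum.distrib sum_distrib_left)

section \<open>The effect of null steps\<close>

text \<open>
  Choose which \<open>m\<close> of the \<open>n\<close> steps belong to \<open>S\<close>; each of the others is one of \<open>r\<close> null steps
  and affects neither the endpoint nor the confinement to the quarter plane. The proof follows
  Pascal's rule.
\<close>

lemma walk_sum_null_steps:
  "walk_sum (S + replicate_mset r (0, 0)) g n =
     (\<Sum>m\<le>n. of_nat (n choose m) * of_nat r ^ (n - m) * walk_sum S g m)"
proof (induction n arbitrary: g)
  case 0
  then show ?case by (simp add: walk_sum_0)
next
  case (Suc n)
  let ?S' = "S + replicate_mset r (0, 0)"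
  have "walk_sum ?S' g (Suc n) = walk_sum ?S' (\<lambda>p. step_op S g p + of_nat r * g p) n"
    unfolding walk_sum_Suc by (rule walk_sum_cong) (simp add: step_op_def flip: zero_prod_def)
  also have "\<dots> = walk_sum ?S' (step_op S g) n + of_nat r * walk_sum ?S' g n"
    by (rule walk_sum_linear)
  also have "walk_sum ?S' (step_op S g) n
      = (\<Sum>m\<le>n. of_nat (n choose m) * of_nat r ^ (n - m) * walk_sum S g (Suc m))"
    by (simp add: Suc.IH walk_sum_Suc)
  also have "of_nat r * walk_sum ?S' g n
      = (\<Sum>m\<le>n. of_nat (n choose m) * of_nat r ^ (Suc n - m) * walk_sum S g m)"
    unfolding Suc.IH sum_distrib_left
    by (intro sum.cong refl) (simp add: Suc_diff_le algebra_simps)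
  also have "\<dots> = of_nat r ^ Suc n * walk_sum S g 0
      + (\<Sum>m\<le>n. of_nat (n choose Suc m) * of_nat r ^ (n - m) * walk_sum S g (Suc m))"
  proof -
    have "(\<Sum>m\<le>n. of_nat (n choose m) * of_nat r ^ (Suc n - m) * walk_sum S g m)
        = (\<Sum>m\<le>Suc n. of_nat (n choose m) * of_nat r ^ (Suc n - m) * walk_sum S g m)"
      by (simp add: binomial_eq_0)
    then show ?thesis by (simp add: sum.atMost_Suc_shift del: sum.atMost_Suc)
  qed
  finally show ?case
    by (simp add: sum.atMost_Suc_shift algebra_simps sum.distrib del: sum.atMost_Suc)
qed

text \<open>
  The coefficients \<open>G m $ n\<close> obey Pascal's rule because \<open>G (m + 1) (1 - c x) = x G m\<close>. In contrast
  to the negative binomial series, this works in every characteristic.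
\<close>

lemma fps_nth_null_step_kernel:
  fixes c :: "'a::field"
  shows "((fps_X / (1 - fps_const c * fps_X)) ^ m * (1 / (1 - fps_const c * fps_X))) $ n
         = of_nat (n choose m) * c ^ (n - m)"
proof -
  define D where "D = 1 - fps_const c * fps_X"
  define G where "G m = (fps_X / D) ^ m * (1 / D)" for m :: nat
  have D0: "D $ 0 \<noteq> 0" by (simp add: D_def)
  \<comment> \<open>\<open>D\<close> is invertible as its constant coefficient is 1, so \<open>/\<close> is genuine division here.\<close>
  have div: "f / D * D = f" for f
    using D0 by (simp add: fps_divide_unit mult.assoc inverse_mult_eq_1)
  have G0: "G 0 * D = 1" using div[of 1] by (simp add: G_def)
  have GS: "G (Suc m) * D = fps_X * G m" for m
    unfolding G_def power_Suc using div[of fps_X] by (metis mult.assoc mult.commute)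
  have nthD: "(f * D) $ Suc n = f $ Suc n - c * f $ n" for f n
    by (simp add: D_def right_diff_distrib mult.left_commute[of f])
  have "G m $ n = of_nat (n choose m) * c ^ (n - m)"
  proof (induction n arbitrary: m)
    case 0
    have "G m $ 0 = (G m * D) $ 0" by (simp add: D_def)
    also have "\<dots> = (if m = 0 then 1 else 0)"
      by (cases m) (simp_all only: G0 GS, simp_all)
    finally show ?case by (cases m) simp_all
  next
    case (Suc n)
    show ?case
    proof (cases m)
      case 0
      have "G 0 $ Suc n = c * G 0 $ n" using nthD[of "G 0" n] by (simp add: G0)
      then show ?thesis using 0 Suc.IH[of 0] by simp
    next
      case (Suc k)
      have "G m $ Suc n = G k $ n + c * G m $ n"
        using nthD[of "G m" n] by (simp add: Suc GS)
      also have "\<dots> = of_nat (n choose k) * c ^ (n - k) + c * (of_nat (n choose Suc k) * c ^ (n - Suc k))"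
        by (simp add: Suc.IH Suc)
      also have "\<dots> = of_nat (n choose k) * c ^ (n - k) + of_nat (n choose Suc k) * c ^ (n - k)"
        by (cases "k < n") (simp_all add: binomial_eq_0 flip: power_Suc mult.assoc Suc_diff_Suc)
      finally show ?thesis by (simp add: Suc algebra_simps)
    qed
  qed
  then show ?thesis by (simp add: G_def D_def)
qed

lemma walk_gf_null_steps:
  fixes a b :: "'a::field"
  shows "walk_gf (S + replicate_mset r (0, 0)) a b =
    fps_compose (walk_gf S a b) (fps_X / (1 - of_nat r * fps_X)) * (1 / (1 - of_nat r * fps_X))"
proof (rule fps_ext)
  fix n
  define g where "g p = a ^ nat (fst p) * b ^ nat (snd p)" for p :: "int \<times> int"
  define V where "V = fps_X / (1 - fps_const (of_nat r :: 'a) * fps_X)"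
  define K where "K = 1 / (1 - fps_const (of_nat r :: 'a) * fps_X)"
  have gf: "walk_gf S' a b $ m = walk_sum S' g m" for S' m
    by (simp add: walk_gf_def walk_sum_def g_def)
  have ker: "(V ^ m * K) $ i = of_nat (i choose m) * of_nat r ^ (i - m)" for m i
    unfolding V_def K_def by (rule fps_nth_null_step_kernel)
  have V0: "V $ 0 = 0" by (simp add: V_def)
  have "(fps_compose (walk_gf S a b) V * K) $ n
      = (\<Sum>i=0..n. (\<Sum>m=0..i. walk_sum S g m * V ^ m $ i) * K $ (n - i))"
    by (simp add: fps_mult_nth fps_compose_nth gf)
  also have "\<dots> = (\<Sum>i=0..n. (\<Sum>m=0..n. walk_sum S g m * V ^ m $ i) * K $ (n - i))"
    \<comment> \<open>The inner range can be extended to \<open>n\<close> since \<open>V\<close> has no constant term, which makes the two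
      ranges independent.\<close>
    by (intro sum.cong refl arg_cong2[where f = "(*)"] sum.mono_neutral_left)
       (auto simp: startsby_zero_power_prefix[OF V0])
  also have "\<dots> = (\<Sum>i=0..n. \<Sum>m=0..n. walk_sum S g m * V ^ m $ i * K $ (n - i))"
    by (simp only: sum_distrib_right)
  also have "\<dots> = (\<Sum>m=0..n. \<Sum>i=0..n. walk_sum S g m * V ^ m $ i * K $ (n - i))"
    by (rule sum.swap)
  also have "\<dots> = (\<Sum>m=0..n. walk_sum S g m * (\<Sum>i=0..n. V ^ m $ i * K $ (n - i)))"
    by (simp only: sum_distrib_left mult.assoc)
  also have "\<dots> = (\<Sum>m\<le>n. walk_sum S g m * (V ^ m * K) $ n)"
    by (simp add: fps_mult_nth atLeast0AtMost)
  also have "\<dots> = walk_sum (S + replicate_mset r (0, 0)) g n"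
    unfolding walk_sum_null_steps ker by (simp only: mult.commute)
  finally show "walk_gf (S + replicate_mset r (0, 0)) a b $ n =
    (fps_compose (walk_gf S a b) (fps_X / (1 - of_nat r * fps_X)) * (1 / (1 - of_nat r * fps_X))) $ n"
    by (simp add: gf V_def K_def fps_of_nat)
qed

section \<open>Active sites of an extended strong-Baxter permutation\<close>

definition shift_value :: "nat \<Rightarrow> nat \<Rightarrow> nat" where
  "shift_value c p = (if p < c then p else p + 1)"

text \<open>
  The site of \<open>\<pi>\<close> from which a site of \<open>append_value \<pi> d\<close> stems: the sites \<open>d\<close> and \<open>d + 1\<close>, just
  below and just above the appended value, both stem from \<open>d\<close>.
\<close>

definition merge_site :: "nat \<Rightarrow> nat \<Rightarrow> nat" where
  "merge_site d c = (if c \<le> d then c else c - 1)"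

text \<open>
  For \<open>u, v\<close> consecutive entries and \<open>x\<close> an earlier one, the disjuncts say that appending a value
  at site \<open>c\<close> completes the first, second or third forbidden pattern. Strict and weak inequalities differ because entries that
  are at least \<open>c\<close> move up by one. Only an \<open>x\<close> strictly between \<open>u\<close> and \<open>v\<close> blocks anything: for
  \<open>u > v\<close>, the first and third patterns together block all sites above \<open>v\<close> up to \<open>u\<close>; for \<open>u < v\<close>,
  the blocked sites are those above \<open>u\<close> up to \<open>x\<close>.
\<close>

definition blocks :: "nat \<Rightarrow> nat \<Rightarrow> nat \<Rightarrow> nat \<Rightarrow> bool" where
  "blocks x u v c \<longleftrightarrow> v < x \<and> x < c \<and> c \<le> u \<or> u < c \<and> c \<le> x \<and> x < v \<or> v < c \<and> c \<le> x \<and> x < u"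

definition blocked :: "nat list \<Rightarrow> nat \<Rightarrow> bool" where
  "blocked \<pi> c \<longleftrightarrow> (\<exists>i j. i < j \<and> j + 1 < length \<pi> \<and> blocks (\<pi> ! i) (\<pi> ! j) (\<pi> ! (j + 1)) c)"

lemma append_value_alt: "append_value \<pi> c = map (shift_value c) \<pi> @ [c]"
  by (simp add: append_value_def shift_value_def fun_eq_iff)

lemma shift_value_less_iff: "shift_value c p < shift_value c q \<longleftrightarrow> p < q"
  by (auto simp: shift_value_def)

lemma shift_value_image: "c \<in> {1..n + 1} \<Longrightarrow> shift_value c ` {1..n} = {1..n + 1} - {c}"
proof (intro equalityI subsetI)
  fix q assume "c \<in> {1..n + 1}" "q \<in> {1..n + 1} - {c}"
  then show "q \<in> shift_value c ` {1..n}"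
    by (intro image_eqI[of _ _ "if q < c then q else q - 1"]) (auto simp: shift_value_def)
qed (auto simp: shift_value_def)

lemma inj_shift_value: "inj (shift_value c)"
  by (auto simp: inj_def shift_value_def split: if_splits)

text \<open>
  Shifting maps the values \<open>1, \<dots>, n\<close> bijectively onto all of \<open>1, \<dots>, n + 1\<close> except \<open>c\<close>.
\<close>

lemma permutation_append_value_iff:
  assumes "c \<in> {1..length \<pi> + 1}"
  shows "append_value \<pi> c \<in> permutations_of_set {1..length \<pi> + 1} \<longleftrightarrow>
         \<pi> \<in> permutations_of_set {1..length \<pi>}"
proof -
  have "c \<notin> shift_value c ` set \<pi>" by (auto simp: shift_value_def)
  moreover have "distinct (map (shift_value c) \<pi>) \<longleftrightarrow> distinct \<pi>"
    using inj_shift_value by (auto simp: distinct_map inj_on_def inj_def)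
  moreover have "insert c (shift_value c ` set \<pi>) = {1..length \<pi> + 1} \<longleftrightarrow>
      shift_value c ` set \<pi> = shift_value c ` {1..length \<pi>}"
    using calculation(1) assms unfolding shift_value_image[OF assms] by blast
  ultimately show ?thesis
    by (auto simp: permutations_of_set_def append_value_alt inj_image_eq_iff[OF inj_shift_value])
qed

text \<open>
  Shifting preserves the order of the old entries, so a forbidden pattern in the extension is
  either one of \<open>\<pi>\<close> or has the new entry in the role of \<open>\<pi>\<^sub>k\<close>.
\<close>

lemma strong_Baxter_append_value_iff:
  assumes "c \<in> {1..length \<pi> + 1}"
  shows "strong_Baxter (append_value \<pi> c) \<longleftrightarrow> strong_Baxter \<pi> \<and> \<not> blocked \<pi> c"
proof -
  let ?n = "length \<pi>" and ?\<rho> = "append_value \<pi> c"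
  define bad where "bad x u v z \<longleftrightarrow> v < x \<and> x < z \<and> z < u \<or> u < z \<and> z < x \<and> x < v \<or> v < z \<and> z < x \<and> x < u"
    for x u v z :: nat
  have old: "?\<rho> ! i = shift_value c (\<pi> ! i)" if "i < ?n" for i
    using that by (simp add: append_value_alt nth_append)
  have new: "?\<rho> ! ?n = c" by (simp add: append_value_alt nth_append)
  have len: "length ?\<rho> = ?n + 1" by (simp add: append_value_def)
  have bad_old: "bad (?\<rho> ! i) (?\<rho> ! j) (?\<rho> ! (j+1)) (?\<rho> ! k) \<longleftrightarrow> bad (\<pi> ! i) (\<pi> ! j) (\<pi> ! (j+1)) (\<pi> ! k)"
    if "i < j" "j + 1 < k" "k < ?n" for i j k
    using that by (simp add: old bad_def shift_value_less_iff)
  have bad_new: "bad (?\<rho> ! i) (?\<rho> ! j) (?\<rho> ! (j+1)) (?\<rho> ! ?n) \<longleftrightarrow> blocks (\<pi> ! i) (\<pi> ! j) (\<pi> ! (j+1)) c"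
    if "i < j" "j + 1 < ?n" for i j
    using that by (auto simp: old new bad_def blocks_def shift_value_def)
  have sB: "strong_Baxter \<sigma> \<longleftrightarrow> \<sigma> \<in> permutations_of_set {1..length \<sigma>} \<and>
      \<not> (\<exists>i j k. i < j \<and> j + 1 < k \<and> k < length \<sigma> \<and> bad (\<sigma> ! i) (\<sigma> ! j) (\<sigma> ! (j+1)) (\<sigma> ! k))" for \<sigma>
    unfolding strong_Baxter_def bad_def by blast
  have split: "(\<exists>i j k. i < j \<and> j + 1 < k \<and> k < n + 1 \<and> P i j k) \<longleftrightarrow>
      (\<exists>i j k. i < j \<and> j + 1 < k \<and> k < n \<and> P i j k) \<or> (\<exists>i j. i < j \<and> j + 1 < n \<and> P i j n)"
    for P and n :: nat
    by (auto simp: less_Suc_eq)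
  have "(\<exists>i j k. i < j \<and> j + 1 < k \<and> k < ?n + 1 \<and> bad (?\<rho> ! i) (?\<rho> ! j) (?\<rho> ! (j+1)) (?\<rho> ! k)) \<longleftrightarrow>
      (\<exists>i j k. i < j \<and> j + 1 < k \<and> k < ?n \<and> bad (?\<rho> ! i) (?\<rho> ! j) (?\<rho> ! (j+1)) (?\<rho> ! k)) \<or>
      (\<exists>i j. i < j \<and> j + 1 < ?n \<and> bad (?\<rho> ! i) (?\<rho> ! j) (?\<rho> ! (j+1)) (?\<rho> ! ?n))"
    by (rule split)
  also have "\<dots> \<longleftrightarrow> (\<exists>i j k. i < j \<and> j + 1 < k \<and> k < ?n \<and> bad (\<pi> ! i) (\<pi> ! j) (\<pi> ! (j+1)) (\<pi> ! k)) \<or> blocked \<pi> c"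
  proof (rule arg_cong2[where f = "(\<or>)"])
    show "(\<exists>i j k. i < j \<and> j + 1 < k \<and> k < ?n \<and> bad (?\<rho> ! i) (?\<rho> ! j) (?\<rho> ! (j+1)) (?\<rho> ! k)) \<longleftrightarrow>
        (\<exists>i j k. i < j \<and> j + 1 < k \<and> k < ?n \<and> bad (\<pi> ! i) (\<pi> ! j) (\<pi> ! (j+1)) (\<pi> ! k))"
      by (intro ex_cong1 conj_cong refl bad_old)
    show "(\<exists>i j. i < j \<and> j + 1 < ?n \<and> bad (?\<rho> ! i) (?\<rho> ! j) (?\<rho> ! (j+1)) (?\<rho> ! ?n)) \<longleftrightarrow> blocked \<pi> c"
      unfolding blocked_def by (intro ex_cong1 conj_cong refl bad_new)
  qed
  finally show ?thesis
    unfolding sB[of ?\<rho>] sB[of \<pi>] len permutation_append_value_iff[OF assms] by blast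
qed

lemma active_sites_eq:
  assumes "strong_Baxter \<pi>"
  shows "active_sites \<pi> = {c \<in> {1..length \<pi> + 1}. \<not> blocked \<pi> c}"
  using assms strong_Baxter_append_value_iff unfolding active_sites_def by blast

lemma strong_Baxter_set: "strong_Baxter \<pi> \<Longrightarrow> set \<pi> = {1..length \<pi>} \<and> distinct \<pi>"
  by (simp add: strong_Baxter_def permutations_of_set_def)

lemma blocks_shift_value:
  "blocks (shift_value d x) (shift_value d u) (shift_value d v) c \<longleftrightarrow> blocks x u v (merge_site d c)"
  by (auto simp: blocks_def shift_value_def merge_site_def)

text \<open>
  The entries before the last one take all values except \<open>last \<pi>\<close>. Hence as soon as a value
  strictly between the two entries of the last pair exists, some earlier entry takes it. For a
  descent any such entry blocks the whole interval, for instance the value \<open>d\<close>, which is shifted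
  to \<open>d + 1\<close>; for an ascent the largest one, \<open>d - 1\<close>, blocks the most.
\<close>

lemma last_pair_blocks_iff:
  assumes "strong_Baxter \<pi>" "\<pi> \<noteq> []" "d \<in> {1..length \<pi> + 1}"
  shows "(\<exists>i < length \<pi> - 1. blocks (shift_value d (\<pi> ! i)) (shift_value d (last \<pi>)) d c) \<longleftrightarrow>
     d < last \<pi> \<and> d < c \<and> c \<le> last \<pi> + 1 \<or> last \<pi> < c \<and> c < d"
    (is "?L \<longleftrightarrow> ?R")
proof -
  let ?n = "length \<pi>" and ?l = "last \<pi>"
  have "set (butlast \<pi>) = {1..?n} - {?l}"
  proof -
    have "set (butlast \<pi> @ [?l]) = {1..?n}" "distinct (butlast \<pi> @ [?l])"
      using assms strong_Baxter_set[of \<pi>] by simp_all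
    then show ?thesis by auto
  qed
  moreover have "?L \<longleftrightarrow> (\<exists>x\<in>set (butlast \<pi>). blocks (shift_value d x) (shift_value d ?l) d c)"
  proof -
    have "set (butlast \<pi>) = (\<lambda>i. butlast \<pi> ! i) ` {..<?n - 1}"
      by (auto simp: set_conv_nth)
    also have "\<dots> = (\<lambda>i. \<pi> ! i) ` {..<?n - 1}"
      by (rule image_cong) (simp_all add: nth_butlast)
    finally show ?thesis by auto
  qed
  ultimately have "?L \<longleftrightarrow> (\<exists>x\<in>{1..?n} - {?l}. blocks (shift_value d x) (shift_value d ?l) d c)"
    by simp
  also have "\<dots> \<longleftrightarrow> ?R"
  proof
    assume "\<exists>x\<in>{1..?n} - {?l}. blocks (shift_value d x) (shift_value d ?l) d c"
    then show ?R by (auto simp: blocks_def shift_value_def split: if_splits)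
  next
    have l: "1 \<le> ?l" "?l \<le> ?n" using strong_Baxter_set[OF assms(1)] last_in_set[OF assms(2)] by auto
    assume ?R
    then show "\<exists>x\<in>{1..?n} - {?l}. blocks (shift_value d x) (shift_value d ?l) d c"
    proof
      assume "d < ?l \<and> d < c \<and> c \<le> ?l + 1"
      then show ?thesis using l assms(3)
        by (intro bexI[of _ d]) (auto simp: blocks_def shift_value_def)
    next
      assume "?l < c \<and> c < d"
      then show ?thesis using l assms(3)
        by (intro bexI[of _ "d - 1"]) (auto simp: blocks_def shift_value_def)
    qed
  qed
  finally show ?thesis .
qed

lemma blocked_append_value_iff:
  assumes "strong_Baxter \<pi>" "\<pi> \<noteq> []" "d \<in> {1..length \<pi> + 1}"
  shows "blocked (append_value \<pi> d) c \<longleftrightarrow> blocked \<pi> (merge_site d c) \<or>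
     d < last \<pi> \<and> d < c \<and> c \<le> last \<pi> + 1 \<or> last \<pi> < c \<and> c < d"
proof -
  let ?n = "length \<pi>" and ?\<rho> = "append_value \<pi> d"
  have old: "?\<rho> ! i = shift_value d (\<pi> ! i)" if "i < ?n" for i
    using that by (simp add: append_value_alt nth_append)
  have new: "?\<rho> ! ?n = d" by (simp add: append_value_alt nth_append)
  obtain m where m: "?n = Suc m" using assms(2) by (cases \<pi>) auto
  have lst: "last \<pi> = \<pi> ! m" using assms(2) m by (simp add: last_conv_nth)
  have split: "(\<exists>i j. i < j \<and> j < Suc m \<and> P i j) \<longleftrightarrow> (\<exists>i j. i < j \<and> j < m \<and> P i j) \<or> (\<exists>i<m. P i m)"
    for P
    by (auto simp: less_Suc_eq)
  have "blocked ?\<rho> c \<longleftrightarrow> (\<exists>i j. i < j \<and> j < Suc m \<and> blocks (?\<rho> ! i) (?\<rho> ! j) (?\<rho> ! (j + 1)) c)"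
    by (simp add: blocked_def append_value_def m)
  also have "\<dots> \<longleftrightarrow> (\<exists>i j. i < j \<and> j < m \<and> blocks (?\<rho> ! i) (?\<rho> ! j) (?\<rho> ! (j + 1)) c) \<or>
      (\<exists>i<m. blocks (?\<rho> ! i) (?\<rho> ! m) (?\<rho> ! (m + 1)) c)"
    by (rule split)
  also have "(\<exists>i j. i < j \<and> j < m \<and> blocks (?\<rho> ! i) (?\<rho> ! j) (?\<rho> ! (j + 1)) c) \<longleftrightarrow> blocked \<pi> (merge_site d c)"
    unfolding blocked_def by (rule ex_cong1)+ (auto simp: m old blocks_shift_value)
  also have "(\<exists>i<m. blocks (?\<rho> ! i) (?\<rho> ! m) (?\<rho> ! (m + 1)) c) \<longleftrightarrow>
      (\<exists>i < ?n - 1. blocks (shift_value d (\<pi> ! i)) (shift_value d (last \<pi>)) d c)"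
    using new by (auto simp: m old lst)
  finally show ?thesis unfolding last_pair_blocks_iff[OF assms] .
qed

lemma active_sites_append_value:
  assumes "strong_Baxter \<pi>" "\<pi> \<noteq> []" "d \<in> active_sites \<pi>"
  shows "c \<in> active_sites (append_value \<pi> d) \<longleftrightarrow> merge_site d c \<in> active_sites \<pi> \<and>
     \<not> (d < last \<pi> \<and> d < c \<and> c \<le> last \<pi> + 1) \<and> \<not> (last \<pi> < c \<and> c < d)"
proof -
  have d: "d \<in> {1..length \<pi> + 1}" and \<rho>: "strong_Baxter (append_value \<pi> d)"
    using assms by (auto simp: active_sites_def)
  have len: "length (append_value \<pi> d) + 1 = length \<pi> + 2" by (simp add: append_value_def)
  have "c \<in> {1..length \<pi> + 2} \<longleftrightarrow> merge_site d c \<in> {1..length \<pi> + 1}"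
    using d by (auto simp: merge_site_def)
  then show ?thesis
    unfolding active_sites_eq[OF assms(1)] active_sites_eq[OF \<rho>] mem_Collect_eq
      blocked_append_value_iff[OF assms(1,2) d] len by blast
qed

text \<open>
  The permutation \<open>\<pi>\<close> is \<open>\<rho>\<close> without its last entry, with the gap closed.
\<close>

lemma strong_Baxter_cases:
  assumes "strong_Baxter \<rho>" "\<rho> \<noteq> []"
  obtains \<pi> c where "strong_Baxter \<pi>" "c \<in> active_sites \<pi>" "\<rho> = append_value \<pi> c"
proof -
  define c where "c = last \<rho>"
  define \<pi> where "\<pi> = map (\<lambda>p. if p < c then p else p - 1) (butlast \<rho>)"
  have dist: "distinct (butlast \<rho> @ [c])" and set: "set \<rho> = {1..length \<rho>}"
    using strong_Baxter_set[OF assms(1)] assms(2) by (auto simp: c_def)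
  have "map (shift_value c) \<pi> = butlast \<rho>"
    unfolding \<pi>_def map_map
  proof (rule map_idI)
    fix p assume "p \<in> set (butlast \<rho>)"
    then have "p \<noteq> c" using dist by auto
    then show "(shift_value c \<circ> (\<lambda>p. if p < c then p else p - 1)) p = p"
      by (auto simp: shift_value_def)
  qed
  then have \<rho>: "\<rho> = append_value \<pi> c"
    using assms(2) by (simp add: append_value_alt c_def)
  have "c \<in> {1..length \<rho>}" unfolding set[symmetric] c_def using assms(2) by simp
  moreover have "length \<rho> = length \<pi> + 1" by (simp add: \<rho> append_value_def)
  ultimately have c: "c \<in> {1..length \<pi> + 1}" by simp
  then have "strong_Baxter \<pi>" using assms(1) strong_Baxter_append_value_iff[OF c] \<rho> by simp
  moreover have "c \<in> active_sites \<pi>" using c assms(1) \<rho> by (simp add: active_sites_def)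
  ultimately show thesis using \<rho> that by blast
qed

lemma append_value_eq_iff: "append_value \<pi> c = append_value \<pi>' c' \<longleftrightarrow> \<pi> = \<pi>' \<and> c = c'"
  using inj_shift_value by (auto simp: append_value_alt)

lemma strong_Baxter_Nil: "strong_Baxter []"
  by (simp add: strong_Baxter_def)

lemma not_blocked_small: "length \<pi> \<le> 2 \<Longrightarrow> \<not> blocked \<pi> c"
  by (auto simp: blocked_def)

lemma active_sites_Nil: "active_sites [] = {1}"
  by (auto simp: active_sites_eq[OF strong_Baxter_Nil] not_blocked_small)

lemma strong_Baxter_singleton: "strong_Baxter [1]"
  using strong_Baxter_append_value_iff[of 1 "[]"] strong_Baxter_Nil not_blocked_small
  by (simp add: append_value_def)

text \<open>
  When \<open>d\<close> has just been appended, the new pair blocks no site equal to \<open>d\<close>, and the site \<open>d\<close>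
  inherits its activity from the site at which \<open>d\<close> was inserted.
\<close>

lemma last_in_active_sites:
  assumes "strong_Baxter \<pi>" "\<pi> \<noteq> []"
  shows "last \<pi> \<in> active_sites \<pi>"
proof -
  obtain \<sigma> d where \<sigma>: "strong_Baxter \<sigma>" "d \<in> active_sites \<sigma>" "\<pi> = append_value \<sigma> d"
    using strong_Baxter_cases[OF assms] .
  have "last \<pi> = d" by (simp add: \<sigma>(3) append_value_def)
  show ?thesis
  proof (cases "\<sigma> = []")
    case True
    then have "\<pi> = [1]" using \<sigma> active_sites_Nil by (simp add: append_value_def)
    then show ?thesis using active_sites_eq[OF assms(1)] not_blocked_small by simp
  next
    case False
    then show ?thesis
      using active_sites_append_value[OF \<sigma>(1) False \<sigma>(2)] \<sigma> \<open>last \<pi> = d\<close>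
      by (simp add: merge_site_def)
  qed
qed

text \<open>
  Every blocked site is at most as large as some entry.
\<close>

lemma top_in_active_sites:
  assumes "strong_Baxter \<pi>"
  shows "length \<pi> + 1 \<in> active_sites \<pi>"
proof -
  have le: "\<pi> ! i \<le> length \<pi>" if "i < length \<pi>" for i
    using nth_mem[OF that] strong_Baxter_set[OF assms] by simp
  have "\<not> blocks (\<pi> ! i) (\<pi> ! j) (\<pi> ! (j + 1)) (length \<pi> + 1)"
    if "i < j" "j + 1 < length \<pi>" for i j
    using that le[of i]
      le[of j]
      le[of "j + 1"]
    by (auto simp: blocks_def)
  then have "\<not> blocked \<pi> (length \<pi> + 1)" unfolding blocked_def by blast
  then show ?thesis by (simp add: active_sites_eq[OF assms])
qed

lemma finite_active_sites: "finite (active_sites \<pi>)"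
  by (simp add: active_sites_def)

lemma label_h_pos: "strong_Baxter \<pi> \<Longrightarrow> \<pi> \<noteq> [] \<Longrightarrow> 0 < label_h \<pi>"
  using last_in_active_sites[of \<pi>] finite_active_sites[of \<pi>]
  by (auto simp: label_h_def card_gt_0_iff)

lemma label_k_pos:
  assumes "strong_Baxter \<pi>" "\<pi> \<noteq> []" shows "0 < label_k \<pi>"
proof -
  have "last \<pi> \<le> length \<pi>" using strong_Baxter_set[OF assms(1)] last_in_set[OF assms(2)] by auto
  then have "length \<pi> + 1 \<in> {c \<in> active_sites \<pi>. last \<pi> < c}"
    using top_in_active_sites[OF assms(1)] by simp
  moreover have "finite {c \<in> active_sites \<pi>. last \<pi> < c}" by (simp add: finite_active_sites)
  ultimately show ?thesis unfolding label_k_def card_gt_0_iff by blast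
qed

text \<open>
  The three cases of the growth rule. If \<open>d\<close> is below the last entry, the new pair blocks the sites
  from the copy of \<open>d\<close> above \<open>d\<close> up to the copies of the old last site, so above \<open>d\<close> only the old
  upper sites survive. If \<open>d\<close> is the last value, nothing is blocked and the site \<open>d\<close> is doubled. If
  \<open>d\<close> is above the last entry, the sites strictly between are blocked, and both copies of \<open>d\<close>
  survive, one on each side of the new last entry.
\<close>

lemma label_append_value:
  assumes "strong_Baxter \<pi>" "\<pi> \<noteq> []" "d \<in> active_sites \<pi>"
  shows label_append_value_below:
      "d < last \<pi> \<Longrightarrow> label_h (append_value \<pi> d) = card {c \<in> active_sites \<pi>. c \<le> d} \<and>
         label_k (append_value \<pi> d) = label_k \<pi>"
    and label_append_value_last:
      "d = last \<pi> \<Longrightarrow> label_h (append_value \<pi> d) = label_h \<pi> \<and>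
         label_k (append_value \<pi> d) = label_k \<pi> + 1"
    and label_append_value_above:
      "last \<pi> < d \<Longrightarrow> label_h (append_value \<pi> d) = label_h \<pi> + 1 \<and>
         label_k (append_value \<pi> d) = card {c \<in> active_sites \<pi>. d \<le> c}"
proof -
  let ?A = "active_sites \<pi>" and ?A' = "active_sites (append_value \<pi> d)" and ?l = "last \<pi>"
  have last: "last (append_value \<pi> d) = d" by (simp add: append_value_def)
  note A' = active_sites_append_value[OF assms]
  have Suc_image: "{c \<in> ?A'. d < c} = Suc ` {c \<in> ?A. m \<le> c}"
    if "\<And>c. d < c \<Longrightarrow> c \<in> ?A' \<longleftrightarrow> c - 1 \<in> ?A \<and> m \<le> c - 1" "d \<le> m" for m
  proof (intro equalityI subsetI)
    fix c assume "c \<in> {c \<in> ?A'. d < c}"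
    then show "c \<in> Suc ` {c \<in> ?A. m \<le> c}"
      using that by (intro image_eqI[of _ _ "c - 1"]) auto
  next
    fix c assume "c \<in> Suc ` {c \<in> ?A. m \<le> c}"
    then obtain e where e: "c = Suc e" "e \<in> ?A" "m \<le> e" by auto
    then show "c \<in> {c \<in> ?A'. d < c}" using that(1)[of c] that(2) by simp
  qed
  {
    assume d: "d < ?l"
    have "{c \<in> ?A'. c \<le> d} = {c \<in> ?A. c \<le> d}" using d by (auto simp: A' merge_site_def)
    moreover have "{c \<in> ?A'. d < c} = Suc ` {c \<in> ?A. Suc ?l \<le> c}"
      by (rule Suc_image) (use d in \<open>auto simp: A' merge_site_def\<close>)
    ultimately show "label_h (append_value \<pi> d) = card {c \<in> ?A. c \<le> d} \<and>
         label_k (append_value \<pi> d) = label_k \<pi>"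
      by (simp add: label_h_def label_k_def last card_image Suc_le_eq)
  }
  {
    assume d: "d = ?l"
    have "{c \<in> ?A'. c \<le> d} = {c \<in> ?A. c \<le> ?l}" by (auto simp: A' merge_site_def d[symmetric])
    moreover have "{c \<in> ?A'. d < c} = Suc ` {c \<in> ?A. ?l \<le> c}"
      by (rule Suc_image) (auto simp: A' merge_site_def d[symmetric])
    moreover have "{c \<in> ?A. ?l \<le> c} = insert ?l {c \<in> ?A. ?l < c}"
      using assms(3) d by auto
    then have "card {c \<in> ?A. ?l \<le> c} = card {c \<in> ?A. ?l < c} + 1"
      by (simp add: finite_active_sites)
    ultimately show "label_h (append_value \<pi> d) = label_h \<pi> \<and>
         label_k (append_value \<pi> d) = label_k \<pi> + 1"
      by (simp only: label_h_def label_k_def last) (simp add: card_image del: image_insert)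
  }
  {
    assume d: "?l < d"
    have "{c \<in> ?A'. c \<le> d} = insert d {c \<in> ?A. c \<le> ?l}"
      using d assms(3) by (auto simp: A' merge_site_def)
    moreover have "{c \<in> ?A'. d < c} = Suc ` {c \<in> ?A. d \<le> c}"
      by (rule Suc_image) (use d in \<open>auto simp: A' merge_site_def\<close>)
    ultimately show "label_h (append_value \<pi> d) = label_h \<pi> + 1 \<and>
         label_k (append_value \<pi> d) = card {c \<in> ?A. d \<le> c}"
      using d by (simp add: label_h_def label_k_def last card_image finite_active_sites)
  }
qed

section \<open>The growth rule for labels\<close>

lemma sum_card_atMost:
  fixes g :: "nat \<Rightarrow> 'a::comm_ring_1" and S :: "nat set"
  assumes "finite S"
  shows "(\<Sum>d\<in>S. g (card {c \<in> S. c \<le> d})) = (\<Sum>i=1..card S. g i)"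
  using assms
proof (induction S rule: finite_linorder_max_induct)
  case (insert b S)
  then have b: "b \<notin> S" by blast
  have "{c \<in> insert b S. c \<le> d} = {c \<in> S. c \<le> d}" if "d \<in> S" for d
    using insert.hyps(2) that by force
  moreover have "{c \<in> insert b S. c \<le> b} = insert b S"
    using insert.hyps(2) by auto
  ultimately show ?case using insert b by (simp add: add.commute)
qed simp

lemma sum_card_atLeast:
  fixes g :: "nat \<Rightarrow> 'a::comm_ring_1" and S :: "nat set"
  assumes "finite S"
  shows "(\<Sum>d\<in>S. g (card {c \<in> S. d \<le> c})) = (\<Sum>i=1..card S. g i)"
  using assms
proof (induction S rule: finite_linorder_min_induct)
  case (insert b S)
  then have b: "b \<notin> S" by blast
  have "{c \<in> insert b S. d \<le> c} = {c \<in> S. d \<le> c}" if "d \<in> S" for d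
    using insert.hyps(2) that by force
  moreover have "{c \<in> insert b S. b \<le> c} = insert b S"
    using insert.hyps(2) by auto
  ultimately show ?case using insert b by (simp add: add.commute)
qed simp

definition children_sum :: "(nat \<Rightarrow> nat \<Rightarrow> 'a::comm_ring_1) \<Rightarrow> nat \<Rightarrow> nat \<Rightarrow> 'a" where
  "children_sum f h k = (\<Sum>i=1..h - 1. f i k) + f h (k + 1) + (\<Sum>j=1..k. f (h + 1) j)"

text \<open>
  The active sites below \<open>last \<pi>\<close> have ranks \<open>1, \<dots>, h - 1\<close> from below, since \<open>last \<pi>\<close> itself is
  the \<open>h\<close>-th one; those above have ranks \<open>1, \<dots>, k\<close> from above.
\<close>

lemma growth_rule:
  assumes "strong_Baxter \<pi>" "\<pi> \<noteq> []"
  shows "(\<Sum>d\<in>active_sites \<pi>. f (label_h (append_value \<pi> d)) (label_k (append_value \<pi> d)))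
       = children_sum f (label_h \<pi>) (label_k \<pi>)"
proof -
  let ?A = "active_sites \<pi>" and ?l = "last \<pi>"
  let ?F = "\<lambda>d. f (label_h (append_value \<pi> d)) (label_k (append_value \<pi> d))"
  define lo hi where "lo = {c \<in> ?A. c < ?l}" and "hi = {c \<in> ?A. ?l < c}"
  have l: "?l \<in> ?A" by (rule last_in_active_sites[OF assms])
  have fin: "finite lo" "finite hi" by (simp_all add: lo_def hi_def finite_active_sites)
  have A: "?A = lo \<union> insert ?l hi" and disj: "lo \<inter> insert ?l hi = {}" "?l \<notin> hi"
    using l by (auto simp: lo_def hi_def)
  have "label_h \<pi> = card (insert ?l lo)"
    unfolding label_h_def lo_def using l by (intro arg_cong[where f = card]) auto
  then have lo: "card lo = label_h \<pi> - 1"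
    using fin by (simp add: lo_def)
  have hi: "card hi = label_k \<pi>" by (simp add: hi_def label_k_def)
  have "(\<Sum>d\<in>lo. ?F d) = (\<Sum>d\<in>lo. f (card {c \<in> lo. c \<le> d}) (label_k \<pi>))"
  proof (rule sum.cong)
    fix d assume d: "d \<in> lo"
    then have "{c \<in> ?A. c \<le> d} = {c \<in> lo. c \<le> d}" by (auto simp: lo_def)
    then show "?F d = f (card {c \<in> lo. c \<le> d}) (label_k \<pi>)"
      using label_append_value_below[OF assms, of d] d by (simp add: lo_def)
  qed simp
  also have "\<dots> = (\<Sum>i=1..label_h \<pi> - 1. f i (label_k \<pi>))"
    unfolding lo[symmetric] by (rule sum_card_atMost[OF fin(1)])
  finally have "(\<Sum>d\<in>lo. ?F d) = \<dots>" .
  moreover have "(\<Sum>d\<in>hi. ?F d) = (\<Sum>d\<in>hi. f (label_h \<pi> + 1) (card {c \<in> hi. d \<le> c}))"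
  proof (rule sum.cong)
    fix d assume d: "d \<in> hi"
    then have "{c \<in> ?A. d \<le> c} = {c \<in> hi. d \<le> c}" by (auto simp: hi_def)
    then show "?F d = f (label_h \<pi> + 1) (card {c \<in> hi. d \<le> c})"
      using label_append_value_above[OF assms, of d] d by (simp add: hi_def)
  qed simp
  then have "(\<Sum>d\<in>hi. ?F d) = (\<Sum>j=1..label_k \<pi>. f (label_h \<pi> + 1) j)"
    using sum_card_atLeast[OF fin(2), of "f (label_h \<pi> + 1)"] hi by simp
  moreover have "?F ?l = f (label_h \<pi>) (label_k \<pi> + 1)"
    using label_append_value_last[OF assms l] by simp
  ultimately show ?thesis
    unfolding A children_sum_def using fin disj by (simp add: sum.union_disjoint add.assoc)
qed

definition label_sum :: "(nat \<Rightarrow> nat \<Rightarrow> 'a::comm_ring_1) \<Rightarrow> nat \<Rightarrow> 'a" where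
  "label_sum f n = (\<Sum>\<pi> | strong_Baxter \<pi> \<and> length \<pi> = n. f (label_h \<pi>) (label_k \<pi>))"

lemma finite_strong_Baxter: "finite {\<pi>. strong_Baxter \<pi> \<and> length \<pi> = n}"
  by (rule finite_subset[of _ "permutations_of_set {1..n}"]) (auto simp: strong_Baxter_def)

text \<open>
  Positivity of both components is what later allows writing a label as \<open>(m + 1, p + 1)\<close>.
\<close>

lemma label_sum_cong:
  assumes "\<And>h k. 0 < h \<Longrightarrow> 0 < k \<Longrightarrow> f h k = f' h k" "0 < n"
  shows "label_sum f n = label_sum f' n"
  unfolding label_sum_def
  by (intro sum.cong refl assms(1)) (use assms(2) label_h_pos label_k_pos in auto)

lemma sum_strong_Baxter_Suc:
  "(\<Sum>\<rho> | strong_Baxter \<rho> \<and> length \<rho> = Suc n. F \<rho>)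
     = (\<Sum>\<pi> | strong_Baxter \<pi> \<and> length \<pi> = n. \<Sum>d\<in>active_sites \<pi>. F (append_value \<pi> d) :: 'a::comm_ring_1)"
proof -
  let ?P = "{\<pi>. strong_Baxter \<pi> \<and> length \<pi> = n}"
  let ?E = "SIGMA \<pi>:?P. active_sites \<pi>"
  have "{\<rho>. strong_Baxter \<rho> \<and> length \<rho> = Suc n} = (\<lambda>(\<pi>, d). append_value \<pi> d) ` ?E"
  proof (intro equalityI subsetI)
    fix \<rho> assume "\<rho> \<in> {\<rho>. strong_Baxter \<rho> \<and> length \<rho> = Suc n}"
    then have \<rho>: "strong_Baxter \<rho>" "\<rho> \<noteq> []" "length \<rho> = Suc n" by auto
    obtain \<pi> d where \<pi>: "strong_Baxter \<pi>" "d \<in> active_sites \<pi>" "\<rho> = append_value \<pi> d"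
      using strong_Baxter_cases[OF \<rho>(1,2)] .
    moreover have "length \<pi> = n" using \<pi>(3) \<rho>(3) by (simp add: append_value_def)
    ultimately show "\<rho> \<in> (\<lambda>(\<pi>, d). append_value \<pi> d) ` ?E" by force
  qed (auto simp: active_sites_def append_value_def)
  moreover have "inj_on (\<lambda>(\<pi>, d). append_value \<pi> d) ?E"
    by (auto simp: inj_on_def append_value_eq_iff)
  ultimately have "(\<Sum>\<rho> | strong_Baxter \<rho> \<and> length \<rho> = Suc n. F \<rho>) = (\<Sum>(\<pi>, d)\<in>?E. F (append_value \<pi> d))"
    by (simp add: sum.reindex case_prod_unfold)
  also have "\<dots> = (\<Sum>\<pi>\<in>?P. \<Sum>d\<in>active_sites \<pi>. F (append_value \<pi> d))"
    by (rule sum.Sigma[symmetric]) (simp_all add: finite_strong_Baxter finite_active_sites)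
  finally show ?thesis .
qed

lemma label_sum_children: "label_sum f (Suc (Suc n)) = label_sum (children_sum f) (Suc n)"
  unfolding label_sum_def sum_strong_Baxter_Suc[where n = "Suc n"]
  by (intro sum.cong refl growth_rule) auto

lemma label_sum_1: "label_sum f 1 = f 1 1"
proof -
  have "active_sites [1] = {1, 2}"
    unfolding active_sites_eq[OF strong_Baxter_singleton] by (auto simp: not_blocked_small)
  then have "{c \<in> active_sites [1]. c \<le> 1} = {1}" "{c \<in> active_sites [1]. 1 < c} = {2}" by auto
  then have "label_h [1] = 1" "label_k [1] = 1" by (simp_all add: label_h_def label_k_def)
  moreover have "{\<pi>. strong_Baxter \<pi> \<and> length \<pi> = 1} = {[1]}"
    using strong_Baxter_singleton by (auto simp: length_Suc_conv strong_Baxter_def permutations_of_set_def)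
  ultimately show ?thesis by (simp add: label_sum_def)
qed

section \<open>From labels to walks by binomial transform\<close>

definition binomial_transform :: "(nat \<Rightarrow> 'a::comm_ring_1) \<Rightarrow> nat \<Rightarrow> 'a" where
  "binomial_transform g m = (\<Sum>i\<le>m. of_nat (m choose i) * g i)"

lemma binomial_transform_0: "binomial_transform g 0 = g 0"
  by (simp add: binomial_transform_def)

lemma binomial_transform_add:
  "binomial_transform (\<lambda>i. g i + g' i) m = binomial_transform g m + binomial_transform g' m"
  by (simp add: binomial_transform_def algebra_simps sum.distrib)

lemma binomial_transform_diff:
  "binomial_transform (\<lambda>i. g i - g' i) m = binomial_transform g m - binomial_transform g' m"
  by (simp add: binomial_transform_def algebra_simps sum_subtractf)

lemma binomial_transform_mult:
  "binomial_transform (\<lambda>i. c * g i) m = c * binomial_transform g m"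
  by (simp add: binomial_transform_def sum_distrib_left algebra_simps)

lemma binomial_transform_sum:
  "binomial_transform (\<lambda>i. \<Sum>q\<in>Q. g q i) m = (\<Sum>q\<in>Q. binomial_transform (g q) m)"
  unfolding binomial_transform_def sum_distrib_left by (rule sum.swap)

lemma binomial_transform_power: "binomial_transform (\<lambda>i. a ^ i) m = (1 + a) ^ m"
  using binomial_ring[of a 1 m] by (simp add: binomial_transform_def add.commute)

lemma binomial_transform_shift:
  "binomial_transform (\<lambda>i. g (Suc i)) m = binomial_transform g (Suc m) - binomial_transform g m"
proof -
  have "binomial_transform g m = (\<Sum>i\<le>Suc m. of_nat (m choose i) * g i)"
    by (simp add: binomial_transform_def binomial_eq_0)
  then show ?thesis
    by (simp add: binomial_transform_def sum.atMost_Suc_shift algebra_simps sum.distrib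
        del: sum.atMost_Suc)
qed

text \<open>
  The preceding lemma identifies the increment of the left-hand side in \<open>m\<close> with
  \<open>binomial_transform g m\<close>.
\<close>

lemma binomial_transform_back_shift:
  "binomial_transform (\<lambda>i. if i = 0 then 0 else g (i - 1)) m = (\<Sum>l<m. binomial_transform g l)"
proof (induction m)
  case (Suc m)
  then show ?case
    using binomial_transform_shift[of "\<lambda>i. if i = 0 then 0 else g (i - 1)" m]
    by (simp add: algebra_simps)
qed (simp add: binomial_transform_0)

definition binomial_transform2 :: "(nat \<Rightarrow> nat \<Rightarrow> 'a::comm_ring_1) \<Rightarrow> nat \<Rightarrow> nat \<Rightarrow> 'a" where
  "binomial_transform2 G m p = binomial_transform (\<lambda>i. binomial_transform (G i) p) m"

abbreviation strong_Baxter_steps :: "(int \<times> int) multiset" where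
  "strong_Baxter_steps \<equiv> {#(-1, 0), (0, -1), (1, -1), (1, 0), (0, 1), (0, 0), (0, 0)#}"

lemma step_op_strong_Baxter:
  "step_op strong_Baxter_steps g (int i, int j) =
     (if i = 0 then 0 else g (int (i - 1), int j)) +
     (if j = 0 then 0 else g (int i, int (j - 1))) +
     (if j = 0 then 0 else g (int (Suc i), int (j - 1))) +
     g (int (Suc i), int j) + g (int i, int (Suc j)) + g (int i, int j) + g (int i, int j)"
  by (cases i; cases j) (simp_all add: step_op_def algebra_simps)

text \<open>
  With \<open>T\<close> the transform of \<open>g\<close>, the seven steps contribute a partial sum for each of west, south
  and south-east (the latter with a difference inside), a difference for each of east and north,
  and \<open>T\<close> twice for the two null steps. The negative terms cancel against the sum for the south
  step and the null steps, leaving the children sum of \<open>T\<close>, with labels lowered by one.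
\<close>

lemma children_sum_binomial_transform2:
  assumes "0 < h" "0 < k"
  shows "children_sum (\<lambda>h k. binomial_transform2 (\<lambda>i j. g (int i, int j)) (h - 1) (k - 1)) h k =
    binomial_transform2 (\<lambda>i j. step_op strong_Baxter_steps g (int i, int j)) (h - 1) (k - 1)"
proof -
  obtain m p where hk: "h = Suc m" "k = Suc p" using assms by (metis gr0_implies_Suc)
  define G where "G i j = g (int i, int j)" for i j
  define T where "T = binomial_transform2 G"
  have west: "binomial_transform2 (\<lambda>i j. if i = 0 then 0 else G (i - 1) j) m p = (\<Sum>l<m. T l p)"
  proof -
    have "binomial_transform (\<lambda>j. if i = 0 then 0 else G (i - 1) j) p =
        (if i = 0 then 0 else binomial_transform (G (i - 1)) p)" for i
      by (simp add: binomial_transform_def)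
    then show ?thesis by (simp add: binomial_transform2_def T_def
          binomial_transform_back_shift[of "\<lambda>i. binomial_transform (G i) p"])
  qed
  have south: "binomial_transform2 (\<lambda>i j. if j = 0 then 0 else H i (j - 1)) m p
      = (\<Sum>q<p. binomial_transform2 H m q)" for H :: "nat \<Rightarrow> nat \<Rightarrow> 'a"
    by (simp add: binomial_transform2_def binomial_transform_back_shift binomial_transform_sum)
  have east: "binomial_transform2 (\<lambda>i j. G (Suc i) j) m q = T (Suc m) q - T m q" for q
    by (simp add: binomial_transform2_def T_def binomial_transform_shift[of "\<lambda>i. binomial_transform (G i) q"])
  have north: "binomial_transform2 (\<lambda>i j. G i (Suc j)) m p = T m (Suc p) - T m p"
    by (simp add: binomial_transform2_def T_def binomial_transform_shift binomial_transform_diff)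
  have add: "binomial_transform2 (\<lambda>i j. H i j + H' i j) m p
      = binomial_transform2 H m p + binomial_transform2 H' m p" for H H' :: "nat \<Rightarrow> nat \<Rightarrow> 'a"
    by (simp add: binomial_transform2_def binomial_transform_add)
  have "binomial_transform2 (\<lambda>i j. step_op strong_Baxter_steps g (int i, int j)) m p
      = (\<Sum>l<m. T l p) + (\<Sum>q<p. T m q) + (\<Sum>q<p. T (Suc m) q - T m q)
        + (T (Suc m) p - T m p) + (T m (Suc p) - T m p) + T m p + T m p"
    unfolding step_op_strong_Baxter G_def[symmetric] add west
      south[of G] south[of "\<lambda>i j. G (Suc i) j"] east north T_def[symmetric] by simp
  also have "\<dots> = (\<Sum>l<m. T l p) + T m (Suc p) + (\<Sum>q<Suc p. T (Suc m) q)"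
    by (simp add: sum_subtractf)
  also have "\<dots> = children_sum (\<lambda>h k. T (h - 1) (k - 1)) h k"
    by (simp add: children_sum_def hk sum.atLeast1_atMost_eq)
  finally show ?thesis by (simp add: hk T_def G_def[abs_def])
qed

text \<open>
  By the intertwining relation, one growth step on labels matches one walk step; the root label
  \<open>(1, 1)\<close> corresponds to the origin.
\<close>

lemma label_sum_eq_walk_sum:
  "label_sum (\<lambda>h k. binomial_transform2 (\<lambda>i j. g (int i, int j)) (h - 1) (k - 1)) (Suc n)
     = walk_sum strong_Baxter_steps g n"
proof (induction n arbitrary: g)
  case 0
  show ?case
    using label_sum_1[of "\<lambda>h k. binomial_transform2 (\<lambda>i j. g (int i, int j)) (h - 1) (k - 1)"]
    by (simp add: walk_sum_0 binomial_transform2_def binomial_transform_0)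
next
  case (Suc n)
  have "label_sum (\<lambda>h k. binomial_transform2 (\<lambda>i j. g (int i, int j)) (h - 1) (k - 1)) (Suc (Suc n))
      = label_sum (\<lambda>h k. binomial_transform2
          (\<lambda>i j. step_op strong_Baxter_steps g (int i, int j)) (h - 1) (k - 1)) (Suc n)"
    unfolding label_sum_children
    by (rule label_sum_cong) (simp_all only: children_sum_binomial_transform2 zero_less_Suc)
  also have "\<dots> = walk_sum strong_Baxter_steps g (Suc n)"
    unfolding walk_sum_Suc by (rule Suc.IH)
  finally show ?case .
qed

section \<open>The two identities\<close>

lemma J_eq_W\<^sub>2: "J a b = fps_const ((1 + a) * (1 + b)) * fps_X * W\<^sub>2 a b"
proof (rule fps_ext)
  fix N
  show "J a b $ N = (fps_const ((1 + a) * (1 + b)) * fps_X * W\<^sub>2 a b) $ N"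
  proof (cases N)
    case 0
    then show ?thesis by (simp add: J_def I_def)
  next
    case (Suc n)
    define g where "g p = a ^ nat (fst p) * b ^ nat (snd p)" for p :: "int \<times> int"
    have g: "binomial_transform2 (\<lambda>i j. g (int i, int j)) m p = (1 + a) ^ m * (1 + b) ^ p" for m p
      by (simp add: binomial_transform2_def g_def binomial_transform_mult binomial_transform_power
          mult.commute[of _ "(1 + b) ^ p"])
    have "J a b $ N = label_sum (\<lambda>h k. (1 + a) ^ h * (1 + b) ^ k) (Suc n)"
      by (simp add: J_def I_def label_sum_def Suc)
    also have "\<dots> = label_sum (\<lambda>h k. (1 + a) * (1 + b) *
        binomial_transform2 (\<lambda>i j. g (int i, int j)) (h - 1) (k - 1)) (Suc n)"
    proof (rule label_sum_cong)
      fix h k :: nat assume "0 < h" "0 < k"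
      then obtain m p where "h = Suc m" "k = Suc p" by (metis gr0_implies_Suc)
      then show "(1 + a) ^ h * (1 + b) ^ k = (1 + a) * (1 + b) *
          binomial_transform2 (\<lambda>i j. g (int i, int j)) (h - 1) (k - 1)"
        unfolding g by (simp add: mult.assoc mult.left_commute)
    qed simp
    also have "\<dots> = (1 + a) * (1 + b) * walk_sum strong_Baxter_steps g n"
      unfolding label_sum_eq_walk_sum[symmetric] label_sum_def by (simp only: sum_distrib_left)
    also have "walk_sum strong_Baxter_steps g n = W\<^sub>2 a b $ n"
      by (simp add: W\<^sub>2_def walk_gf_def walk_sum_def g_def)
    finally show ?thesis by (simp add: Suc mult.assoc)
  qed
qed

theorem lemma26:
  fixes a b :: "'a::field"
  shows "W\<^sub>2 a b = fps_compose (W a b) (fps_X / (1 - 2 * fps_X)) * (1 / (1 - 2 * fps_X)) \<and>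
         J a b = fps_const ((1 + a) * (1 + b)) * fps_X * W\<^sub>2 a b"
proof
  have "strong_Baxter_steps = {#(-1, 0), (0, -1), (1, -1), (1, 0), (0, 1)#} + replicate_mset 2 (0, 0)"
    by (simp add: numeral_2_eq_2 add_mset_commute)
  then show "W\<^sub>2 a b = fps_compose (W a b) (fps_X / (1 - 2 * fps_X)) * (1 / (1 - 2 * fps_X))"
    using walk_gf_null_steps[of "{#(-1, 0), (0, -1), (1, -1), (1, 0), (0, 1)#}" 2 a b]
    by (simp add: W_def W\<^sub>2_def)
qed (rule J_eq_W\<^sub>2)

end
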